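(* Let $(A,R)$ be a complete filtered associative unital Rota--Baxter algebra of weight zero, with $R$ preserving the filtration $\{A^n\}_{n\ge 0}$. The weight-zero CBHD recursion $\chi^0:A^1\to A^1$ (associated with $R$) is given, for $a\in A^1$, by $$ \chi^0(a)=\frac{\operatorname{ad}R(\chi^0(a))}{e^{\operatorname{ad}R(\chi^0(a))}-1}(a) = a+\sum_{n>0}\frac{B_n}{n!}\,\bigl[\operatorname{ad}R(\chi^0(a))\bigr]^n(a). $$ Moreover, for every $a\in A^1$: 1. The equation $x=1+R(a\,x)$ has a unique solution $x\in A$, namely $x=\exp\bigl(R(\chi^0(a))\bigr)$. 2. The equation $y=1-R(y\,a)$ has a unique solution $y\in A$, namely $y=\exp\bigl(R(-\chi^0(a))\bigr)=\exp\bigl(-R(\chi^0(a))\bigr)$.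
   Context: Algebras are over a field of characteristic zero (real or complex numbers). A complete filtered algebra is an associative unital algebra $A$ with a decreasing filtration by subalgebras $A=A^0\supset A^1\supset\dots\supset A^n\supset\cdots$ such that $A^mA^n\subseteq A^{m+n}$ and $A\cong\varprojlim A/A^n$; that is, $A$ is (Hausdorff and) complete for the topology determined by $\{A^n\}$. A Rota--Baxter map of weight zero on $A$ is a linear map $R:A\to A$ with $R(a)R(b)=R(R(a)b)+R(aR(b))$ for all $a,b\in A$. The map $R$ preserves the filtration if $R(A^n)\subseteq A^n$ for all $n$. $\operatorname{ad}u\,(v)=[u,v]=uv-vu$. The $B_n$ are the Bernoulli numbers, $\frac{z}{e^z-1}=\sum_{n\ge0}\frac{B_n}{n!}z^n$ (so $B_1=-\tfrac12$). For $u\in A^1$, $\exp(u)=\sum_{n\ge0}u^n/n!$. All infinite series converge in the topology of the filtration. The weight-zero CBHD (Campbell--Baker--Hausdorff--Dynkin) recursion $\chi^0:A^1\to A^1$ associated with a filtration-preserving linear map $P$ is the (nonlinear) map inductively defined, by iteration in the filtration, by $\chi^0(a)=a+\sum_{n>0}\frac{B_n}{n!}[\operatorname{ad}P(\chi^0(a))]^n(a)$; here $P=R$. *)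

theory Defs
  imports Complex_Main "HOL-Computational_Algebra.Formal_Power_Series"
begin

section \<open>Limits and series in the topology of a filtration\<close>

text \<open>The sets \<open>F n\<close> form a neighbourhood basis of 0. The values \<open>filt_lim\<close> and
  \<open>filt_suminf\<close> are meaningful only for convergent sequences and series; in a complete
  filtered algebra limits are unique (see \<open>filt_lim_eqI\<close> below).\<close>

definition filt_tendsto :: "(nat \<Rightarrow> 'a::ab_group_add set) \<Rightarrow> (nat \<Rightarrow> 'a) \<Rightarrow> 'a \<Rightarrow> bool" where
  "filt_tendsto F s x \<longleftrightarrow> (\<forall>n. \<forall>\<^sub>F m in sequentially. s m - x \<in> F n)"

definition filt_lim :: "(nat \<Rightarrow> 'a::ab_group_add set) \<Rightarrow> (nat \<Rightarrow> 'a) \<Rightarrow> 'a" where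
  "filt_lim F s = (THE x. filt_tendsto F s x)"

definition filt_sums :: "(nat \<Rightarrow> 'a::ab_group_add set) \<Rightarrow> (nat \<Rightarrow> 'a) \<Rightarrow> 'a \<Rightarrow> bool" where
  "filt_sums F f s \<longleftrightarrow> filt_tendsto F (\<lambda>n. \<Sum>i<n. f i) s"

definition filt_suminf :: "(nat \<Rightarrow> 'a::ab_group_add set) \<Rightarrow> (nat \<Rightarrow> 'a) \<Rightarrow> 'a" where
  "filt_suminf F f = filt_lim F (\<lambda>n. \<Sum>i<n. f i)"


section \<open>Complete filtered algebras and Rota--Baxter maps\<close>

text \<open>The sort \<open>{ring, monoid_mult}\<close> is that of unital associative rings in which
  \<open>0 = 1\<close> is not excluded (unlike \<open>ring_1\<close>). That each \<open>F n\<close> is a (not necessarily unital)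
  subalgebra follows from \<open>filt_subspace\<close>, \<open>filt_mult\<close> and \<open>filt_decreasing\<close>.

  The last axiom says that the canonical map from the algebra to the inverse limit of its
  quotients by the \<open>F n\<close> is bijective: an element of that limit is given by representatives
  \<open>s n\<close> whose classes modulo \<open>F n\<close> are compatible, and it has exactly one preimage \<open>x\<close>.\<close>

locale complete_filtered_algebra = vector_space scale
  for scale :: "'k::field_char_0 \<Rightarrow> 'a::{ring,monoid_mult} \<Rightarrow> 'a" +
  fixes F :: "nat \<Rightarrow> 'a set"
  assumes scale_mult_left: "scale c x * y = scale c (x * y)"
    and scale_mult_right: "x * scale c y = scale c (x * y)"
    and filt_0: "F 0 = UNIV"
    and filt_decreasing: "F (Suc n) \<subseteq> F n"
    and filt_subspace: "subspace (F n)"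
    and filt_mult: "x \<in> F m \<Longrightarrow> y \<in> F n \<Longrightarrow> x * y \<in> F (m + n)"
    and filt_complete:
      "(\<And>n. s (Suc n) - s n \<in> F n) \<Longrightarrow> \<exists>!x. \<forall>n. x - s n \<in> F n"

locale complete_filtered_rota_baxter_algebra = complete_filtered_algebra scale F
  for scale :: "'k::field_char_0 \<Rightarrow> 'a::{ring,monoid_mult} \<Rightarrow> 'a" and F :: "nat \<Rightarrow> 'a set" +
  fixes R :: "'a \<Rightarrow> 'a"
  assumes R_linear: "Vector_Spaces.linear scale scale R"
    and rota_baxter: "R a * R b = R (R a * b) + R (a * R b)"
    and R_filt: "R ` F n \<subseteq> F n"


section \<open>Bernoulli numbers, exponential and the CBHD recursion\<close>

text \<open>The formal power series $z/(e^z-1)$. Division of power series over a field cancels the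
  common factor \<open>fps_X\<close>, see \<open>bernoulli_fps_times\<close>.\<close>

definition bernoulli_fps :: "'k::field_char_0 fps" where
  "bernoulli_fps = fps_X / (fps_exp 1 - 1)"

definition bernoulli :: "nat \<Rightarrow> 'k::field_char_0" where
  "bernoulli n = fact n * fps_nth bernoulli_fps n"

definition ad :: "'a::ring \<Rightarrow> 'a \<Rightarrow> 'a" where
  "ad u v = u * v - v * u"

definition filt_exp ::
  "('k::field_char_0 \<Rightarrow> 'a::{ring,monoid_mult} \<Rightarrow> 'a) \<Rightarrow> (nat \<Rightarrow> 'a set) \<Rightarrow> 'a \<Rightarrow> 'a" where
  "filt_exp scale F u = filt_suminf F (\<lambda>n. scale (1 / fact n) (u ^ n))"

text \<open>The value $f(T)(a)$ of a formal power series $f$ at an operator $T$, applied to $a$.\<close>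

definition fps_operator ::
  "('k::field_char_0 \<Rightarrow> 'a::ring \<Rightarrow> 'a) \<Rightarrow> (nat \<Rightarrow> 'a set) \<Rightarrow> 'k fps \<Rightarrow> ('a \<Rightarrow> 'a) \<Rightarrow> 'a \<Rightarrow> 'a" where
  "fps_operator scale F f T a = filt_suminf F (\<lambda>n. scale (fps_nth f n) ((T ^^ n) a))"

text \<open>The right-hand side of the recursion, as a function of the current approximation \<open>c\<close>;
  the sum over $n > 0$ is indexed by \<open>Suc n\<close>.\<close>

definition cbhd_step ::
  "('k::field_char_0 \<Rightarrow> 'a::ring \<Rightarrow> 'a) \<Rightarrow> (nat \<Rightarrow> 'a set) \<Rightarrow> ('a \<Rightarrow> 'a) \<Rightarrow> 'a \<Rightarrow> 'a \<Rightarrow> 'a" where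
  "cbhd_step scale F P a c =
     a + filt_suminf F (\<lambda>n. scale (bernoulli (Suc n) / fact (Suc n)) ((ad (P c) ^^ Suc n) a))"

definition cbhd_recursion ::
  "('k::field_char_0 \<Rightarrow> 'a::ring \<Rightarrow> 'a) \<Rightarrow> (nat \<Rightarrow> 'a set) \<Rightarrow> ('a \<Rightarrow> 'a) \<Rightarrow> 'a \<Rightarrow> 'a" where
  "cbhd_recursion scale F P a = filt_lim F (\<lambda>k. (cbhd_step scale F P a ^^ k) a)"


section \<open>Well-definedness\<close>

lemma bernoulli_fps_times: "bernoulli_fps * (fps_exp 1 - 1) = (fps_X :: 'k::field_char_0 fps)"
proof -
  have n1: "fps_nth (fps_exp 1 - 1 :: 'k fps) 1 \<noteq> 0" and n0: "fps_nth (fps_exp 1 - 1 :: 'k fps) 0 = 0"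
    by simp_all
  then have "subdegree (fps_exp 1 - 1 :: 'k fps) = 1"
    by (intro subdegreeI) auto
  moreover have "(fps_exp 1 - 1 :: 'k fps) \<noteq> 0"
    using n1 by force
  ultimately have "(fps_exp 1 - 1 :: 'k fps) dvd fps_X"
    by (simp add: fps_dvd_iff)
  then show ?thesis
    unfolding bernoulli_fps_def by simp
qed

lemma bernoulli_0_1: "bernoulli 0 = (1::'k::field_char_0)" "bernoulli 1 = (- 1 / 2::'k)"
proof -
  have "fps_nth (bernoulli_fps * (fps_exp 1 - 1)) 1 = fps_nth (fps_X :: 'k fps) 1"
    by (simp only: bernoulli_fps_times)
  then have b0: "fps_nth bernoulli_fps 0 = (1::'k)"
    by (simp add: fps_mult_nth)
  have "fps_nth (bernoulli_fps * (fps_exp 1 - 1)) 2 = fps_nth (fps_X :: 'k fps) 2"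
    by (simp only: bernoulli_fps_times)
  then have "fps_nth bernoulli_fps 1 + 1 / 2 = (0::'k)"
    using b0 by (simp add: fps_mult_nth numeral_2_eq_2 add.commute)
  then have b1: "fps_nth bernoulli_fps 1 = (- 1 / 2::'k)"
    by (simp add: eq_neg_iff_add_eq_0)
  show "bernoulli 0 = (1::'k)" "bernoulli 1 = (- 1 / 2::'k)"
    using b0 b1 by (simp_all add: bernoulli_def)
qed

context complete_filtered_algebra
begin

lemma filt_antimono: "m \<le> n \<Longrightarrow> F n \<subseteq> F m"
  by (rule lift_Suc_antimono_le[of F, OF filt_decreasing])

lemma filt_separated: "(\<And>n. x \<in> F n) \<Longrightarrow> x = 0"
  using filt_complete[of "\<lambda>_. 0"] subspace_0[OF filt_subspace] by auto

lemma filt_tendsto_unique: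
  assumes "filt_tendsto F s x" "filt_tendsto F s y"
  shows "x = y"
proof -
  have "x - y \<in> F n" for n
  proof -
    have "\<forall>\<^sub>F m in sequentially. s m - x \<in> F n \<and> s m - y \<in> F n"
      using assms by (auto simp: filt_tendsto_def eventually_conj_iff)
    then obtain m where "s m - x \<in> F n" "s m - y \<in> F n"
      using eventually_happens'[OF sequentially_bot] by blast
    from subspace_diff[OF filt_subspace this(2,1)] show ?thesis by simp
  qed
  then show ?thesis using filt_separated[of "x - y"] by simp
qed

lemma filt_lim_eqI: "filt_tendsto F s x \<Longrightarrow> filt_lim F s = x"
  unfolding filt_lim_def by (blast intro: filt_tendsto_unique the_equality)

lemma filt_sums_suminf:
  assumes "\<And>n. f n \<in> F n"
  shows "filt_sums F f (filt_suminf F f)"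
proof -
  let ?s = "\<lambda>n. \<Sum>i<n. f i"
  obtain x where x: "\<And>n. x - ?s n \<in> F n"
    using filt_complete[of ?s] assms by auto
  have "\<forall>\<^sub>F m in sequentially. ?s m - x \<in> F n" for n
    using eventually_ge_at_top[of n]
  proof eventually_elim
    case (elim m)
    then have "x - ?s m \<in> F n" using x[of m] filt_antimono by blast
    from subspace_neg[OF filt_subspace this] show ?case by simp
  qed
  then have "filt_tendsto F ?s x" by (simp add: filt_tendsto_def)
  then show ?thesis by (simp add: filt_sums_def filt_suminf_def filt_lim_eqI)
qed

lemma filt_exp_sums:
  assumes "u \<in> F 1"
  shows "filt_sums F (\<lambda>n. scale (1 / fact n) (u ^ n)) (filt_exp scale F u)"
proof -
  have "u ^ n \<in> F n" for n
    by (induction n) (use filt_0 filt_mult[OF assms] in auto)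
  then show ?thesis
    unfolding filt_exp_def by (intro filt_sums_suminf subspace_scale[OF filt_subspace])
qed

lemma ad_power_filt:
  assumes "u \<in> F 1"
  shows "(ad u ^^ n) a \<in> F n"
proof (induction n)
  case (Suc n)
  have "u * (ad u ^^ n) a \<in> F (Suc n)" "(ad u ^^ n) a * u \<in> F (Suc n)"
    using filt_mult[OF assms Suc] filt_mult[OF Suc assms] by simp_all
  then show ?case using subspace_diff[OF filt_subspace] by (auto simp: ad_def[of u "(ad u ^^ n) a"])
qed (simp add: filt_0)

lemma fps_operator_ad_sums:
  assumes "u \<in> F 1"
  shows "filt_sums F (\<lambda>n. scale (fps_nth f n) ((ad u ^^ n) a)) (fps_operator scale F f (ad u) a)"
  unfolding fps_operator_def
  by (intro filt_sums_suminf subspace_scale[OF filt_subspace] ad_power_filt assms)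

lemma cbhd_step_sums:
  assumes "P c \<in> F 1"
  shows "filt_sums F (\<lambda>n. scale (bernoulli (Suc n) / fact (Suc n)) ((ad (P c) ^^ Suc n) a))
           (cbhd_step scale F P a c - a)"
proof -
  have "(ad (P c) ^^ Suc n) a \<in> F n" for n
    using ad_power_filt[OF assms, of "Suc n" a] filt_decreasing by blast
  then have "scale (bernoulli (Suc n) / fact (Suc n)) ((ad (P c) ^^ Suc n) a) \<in> F n" for n
    by (rule subspace_scale[OF filt_subspace])
  from filt_sums_suminf[OF this] show ?thesis by (simp add: cbhd_step_def)
qed

end

end

theory Submission
  imports Defs
begin

text \<open>
  Put $u = R(c)$ with $c = \chi^0(a)$, and let $\psi(z) = (e^z - 1)/z$, the inverse of the series
  $z/(e^z-1)$ that defines the recursion. Solving the recursion for \<open>a\<close> gives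
  $a = \psi(\operatorname{ad} u)(c)$. Two identities turn this into the claim about $\exp(u)$.
  Iterating the Rota--Baxter relation yields $u^{n+1} = R(S_n)$ with
  $S_n = \sum_{i+j=n} u^i c u^j$ (\<open>R_geometric_sum\<close>); this is the integrated form of
  the Leibniz rule for $u^{n+1}$. Moving all powers of $u$ to the right of \<open>c\<close> gives
  $S_n = \sum_k \binom{n+1}{k+1} (\operatorname{ad} u)^k(c)\, u^{n-k}$ (\<open>sum_power_mult_power\<close>),
  which after division by $(n+1)!$ is a Cauchy product, so
  $\sum_n S_n/(n+1)! = \psi(\operatorname{ad} u)(c) \exp(u) = a \exp(u)$. Applying \<open>R\<close> to this
  series gives $\exp(u) - 1 = R(a \exp(u))$.

  The second equation follows from the first without a mirrored computation: the Rota--Baxter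
  relation alone shows that $x = 1 + R(ax)$ and $y = 1 - R(ya)$ imply $yx = 1$
  (\<open>rota_baxter_solutions_inverse\<close>), so \<open>y\<close> is the inverse $\exp(-u)$ of $\exp(u)$.

  Existence of $\chi^0(a)$ and of \<open>y\<close>, and uniqueness everywhere, come from one contraction
  principle: a self-map of some \<open>F m\<close> that sends elements congruent modulo \<open>F n\<close> to elements
  congruent modulo \<open>F (Suc n)\<close> has exactly one fixed point, the limit of its iterates. The
  recursion (on \<open>F 1\<close>) and both equations (on \<open>F 0\<close>, the whole algebra) are of this kind
  because \<open>a\<close> lies in \<open>F 1\<close>.
\<close>

section \<open>Series and contractions in a complete filtered algebra\<close>

text \<open>The common generalization of left multiplication by \<open>u\<close> and of \<open>ad u\<close>, for \<open>u \<in> F 1\<close>: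
  every power series can be evaluated at such an operator, so the exponential and the recursion
  share one functional calculus.\<close>

definition filt_raising :: "('k \<Rightarrow> 'a::ab_group_add \<Rightarrow> 'a) \<Rightarrow> (nat \<Rightarrow> 'a set) \<Rightarrow> ('a \<Rightarrow> 'a) \<Rightarrow> bool" where
  "filt_raising scale F T \<longleftrightarrow>
     (\<forall>x y. T (x + y) = T x + T y) \<and> (\<forall>c x. T (scale c x) = scale c (T x)) \<and>
     (\<forall>n. \<forall>x \<in> F n. T x \<in> F (Suc n))"

context complete_filtered_algebra
begin

lemma filt_UNIV [simp]: "x \<in> F 0"
  by (simp add: filt_0)

lemma filt_zero [simp]: "0 \<in> F n"
  by (rule subspace_0[OF filt_subspace])

lemma filt_add: "x \<in> F n \<Longrightarrow> y \<in> F n \<Longrightarrow> x + y \<in> F n"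
  by (rule subspace_add[OF filt_subspace])

lemma filt_diff: "x \<in> F n \<Longrightarrow> y \<in> F n \<Longrightarrow> x - y \<in> F n"
  by (rule subspace_diff[OF filt_subspace])

lemma filt_minus: "x \<in> F n \<Longrightarrow> - x \<in> F n"
  by (rule subspace_neg[OF filt_subspace])

lemma filt_scale: "x \<in> F n \<Longrightarrow> scale c x \<in> F n"
  by (rule subspace_scale[OF filt_subspace])

lemma filt_sum: "(\<And>i. i \<in> I \<Longrightarrow> f i \<in> F n) \<Longrightarrow> sum f I \<in> F n"
  by (rule subspace_sum[OF filt_subspace])

lemma filt_le: "m \<le> n \<Longrightarrow> x \<in> F n \<Longrightarrow> x \<in> F m"
  using filt_antimono by blast

lemma filt_power: "u \<in> F 1 \<Longrightarrow> u ^ n \<in> F n"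
  by (induction n) (use filt_mult[of u 1] in auto)

lemma filt_trans:
  assumes "x - y \<in> F n" "y - z \<in> F n"
  shows "x - z \<in> F n"
  using filt_add[OF assms] by simp

lemma filt_commute: "x - y \<in> F n \<Longrightarrow> y - x \<in> F n"
  using filt_minus[of "x - y"] by simp

text \<open>Convergence of a series whose \<open>n\<close>-th term has degree \<open>n\<close> is an explicit congruence
  for each truncation; all series below are handled in this form.\<close>

lemma filt_sums_iff:
  assumes f: "\<And>n. f n \<in> F n"
  shows "filt_sums F f s \<longleftrightarrow> (\<forall>n. s - (\<Sum>i<n. f i) \<in> F n)"
proof
  assume "filt_sums F f s"
  show "\<forall>n. s - (\<Sum>i<n. f i) \<in> F n"
  proof
    fix n
    have "\<forall>\<^sub>F m in sequentially. (\<Sum>i<m. f i) - s \<in> F n \<and> m \<ge> n"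
      using \<open>filt_sums F f s\<close> eventually_ge_at_top[of n]
      by (auto simp: filt_sums_def filt_tendsto_def eventually_conj_iff)
    then obtain m where m: "(\<Sum>i<m. f i) - s \<in> F n" "m \<ge> n"
      using eventually_happens'[OF sequentially_bot] by blast
    have "(\<Sum>i<m. f i) - (\<Sum>i<n. f i) = sum f ({..<m} - {..<n})"
      using m(2) by (subst sum_diff) auto
    also have "\<dots> \<in> F n"
      using f by (intro filt_sum) (auto intro: filt_le)
    finally show "s - (\<Sum>i<n. f i) \<in> F n"
      using filt_trans[OF filt_commute[OF m(1)]] by blast
  qed
next
  assume s: "\<forall>n. s - (\<Sum>i<n. f i) \<in> F n"
  have "\<forall>\<^sub>F m in sequentially. (\<Sum>i<m. f i) - s \<in> F n" for n
    using eventually_ge_at_top[of n]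
    by eventually_elim (use s filt_commute filt_le in blast)
  then show "filt_sums F f s"
    by (simp add: filt_sums_def filt_tendsto_def)
qed

lemma filt_sums_remainder:
  "\<lbrakk>filt_sums F f s; \<And>n. f n \<in> F n\<rbrakk> \<Longrightarrow> s - (\<Sum>i<n. f i) \<in> F n"
  using filt_sums_iff by blast

lemma filt_sums_unique: "filt_sums F f s \<Longrightarrow> filt_sums F f t \<Longrightarrow> s = t"
  unfolding filt_sums_def by (rule filt_tendsto_unique)

lemma filt_suminf_eqI: "filt_sums F f s \<Longrightarrow> filt_suminf F f = s"
  unfolding filt_sums_def filt_suminf_def by (rule filt_lim_eqI)

lemma filt_sums_split_head:
  assumes "filt_sums F f s"
  shows "filt_sums F (\<lambda>n. f (Suc n)) (s - f 0)"
proof -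
  have "\<forall>\<^sub>F m in sequentially. (\<Sum>i<m. f (Suc i)) - (s - f 0) \<in> F n" for n
  proof -
    have "\<forall>\<^sub>F m in sequentially. (\<Sum>i<Suc m. f i) - s \<in> F n"
      using assms by (subst eventually_sequentially_Suc) (simp add: filt_sums_def filt_tendsto_def)
    then show ?thesis
      by (simp only: sum.lessThan_Suc_shift) (simp add: algebra_simps)
  qed
  then show ?thesis
    by (simp add: filt_sums_def filt_tendsto_def)
qed

text \<open>The square and the triangle of a Cauchy product differ only by terms of degree
  at least \<open>N\<close>.\<close>

lemma square_sum_minus_triangle_sum:
  assumes h: "\<And>i j. h i j \<in> F (i + j)"
  shows "(\<Sum>i<N. \<Sum>j<N. h i j) - (\<Sum>n<N. \<Sum>i\<le>n. h i (n - i)) \<in> F N"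
proof -
  let ?h = "\<lambda>(i, j). h i j"
  have "(\<Sum>i<N. \<Sum>j<N. h i j) = sum ?h ({..<N} \<times> {..<N})"
    by (rule sum.cartesian_product)
  moreover have "(\<Sum>n<N. \<Sum>i\<le>n. h i (n - i)) = sum ?h {(i, j). i + j < N}"
    by (rule sum.triangle_reindex[symmetric])
  moreover have "sum ?h ({..<N} \<times> {..<N}) - sum ?h {(i, j). i + j < N}
      = sum ?h ({..<N} \<times> {..<N} - {(i, j). i + j < N})"
    by (subst sum_diff) auto
  moreover have "\<dots> \<in> F N"
    by (intro filt_sum) (auto intro!: filt_le[OF _ h])
  ultimately show ?thesis by simp
qed

lemma filt_sums_Cauchy_product:
  assumes f: "\<And>n. f n \<in> F n" "filt_sums F f s" and g: "\<And>n. g n \<in> F n" "filt_sums F g t"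
  shows "filt_sums F (\<lambda>n. \<Sum>i\<le>n. f i * g (n - i)) (s * t)"
proof -
  have h: "f i * g j \<in> F (i + j)" for i j
    using f(1) g(1) by (rule filt_mult)
  have deg: "(\<Sum>i\<le>n. f i * g (n - i)) \<in> F n" for n
    by (rule filt_sum) (auto intro!: filt_le[OF _ h])
  show ?thesis
    unfolding filt_sums_iff[OF deg]
  proof
    fix N
    let ?f = "\<Sum>i<N. f i" and ?g = "\<Sum>i<N. g i"
    have "(s - ?f) * t \<in> F (N + 0)"
      using filt_sums_remainder[OF f(2,1)] by (intro filt_mult) auto
    moreover have "?f * (t - ?g) \<in> F (0 + N)"
      using filt_sums_remainder[OF g(2,1)] by (intro filt_mult) auto
    ultimately have "(s - ?f) * t + ?f * (t - ?g) \<in> F N"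
      by (intro filt_add) auto
    then have "s * t - ?f * ?g \<in> F N"
      by (simp add: algebra_simps)
    moreover have "?f * ?g - (\<Sum>n<N. \<Sum>i\<le>n. f i * g (n - i)) \<in> F N"
      using square_sum_minus_triangle_sum[OF h] by (simp add: sum_product)
    ultimately show "s * t - (\<Sum>n<N. \<Sum>i\<le>n. f i * g (n - i)) \<in> F N"
      by (rule filt_trans)
  qed
qed

text \<open>Two fixed points are congruent modulo \<open>F n\<close> for every \<open>n\<close>, by induction on \<open>n\<close>, and the
  filtration is separated.\<close>

lemma contraction_fixed_point_unique:
  assumes contr: "\<And>n c d. c \<in> S \<Longrightarrow> d \<in> S \<Longrightarrow> c - d \<in> F n \<Longrightarrow> f c - f d \<in> F (Suc n)"
    and "c \<in> S" "d \<in> S" "f c = c" "f d = d"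
  shows "c = d"
proof -
  have "c - d \<in> F n" for n
  proof (induction n)
    case (Suc n)
    from contr[OF assms(2,3) Suc] show ?case by (simp add: assms(4,5))
  qed simp
  from filt_separated[OF this] show ?thesis by simp
qed

text \<open>Consecutive iterates agree modulo higher and higher \<open>F k\<close>, so they converge by
  completeness; the limit is fixed since the contraction property makes the map continuous.\<close>

lemma contraction_iterates_tendsto:
  assumes contr: "\<And>n c d. c \<in> F m \<Longrightarrow> d \<in> F m \<Longrightarrow> c - d \<in> F n \<Longrightarrow> f c - f d \<in> F (Suc n)"
    and maps: "\<And>c. c \<in> F m \<Longrightarrow> f c \<in> F m" and a: "a \<in> F m"
  obtains x where "filt_tendsto F (\<lambda>k. (f ^^ k) a) x" "x \<in> F m" "f x = x"
proof -
  define s where "s k = (f ^^ k) a" for k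
  have s_Suc: "s (Suc k) = f (s k)" for k
    by (simp add: s_def)
  have s_in: "s k \<in> F m" for k
    by (induction k) (use a maps in \<open>auto simp: s_def\<close>)
  have "s (Suc k) - s k \<in> F k" for k
  proof (induction k)
    case (Suc k)
    from contr[OF s_in s_in Suc] show ?case by (simp only: s_Suc)
  qed simp
  then obtain x where x: "\<And>n. x - s n \<in> F n"
    using filt_complete[of s] by blast
  have x_in: "x \<in> F m"
    using filt_add[OF x[of m] s_in[of m]] by simp
  have "\<forall>\<^sub>F k in sequentially. s k - x \<in> F n" for n
    using eventually_ge_at_top[of n]
    by eventually_elim (use x filt_commute filt_le in blast)
  then have "filt_tendsto F (\<lambda>k. (f ^^ k) a) x"
    by (simp add: filt_tendsto_def s_def)
  moreover have "f x - x \<in> F n" for n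
  proof -
    have "f x - s (Suc n) \<in> F (Suc n)"
      using contr[OF x_in s_in x] by (simp add: s_Suc)
    from filt_trans[OF this filt_commute[OF x]] show ?thesis
      by (rule filt_le[rotated]) simp
  qed
  then have "f x = x"
    using filt_separated[of "f x - x"] by simp
  ultimately show ?thesis
    using that x_in by blast
qed

section \<open>Power series in an operator that raises the degree\<close>

lemma filt_raising_left_mult: "u \<in> F 1 \<Longrightarrow> filt_raising scale F (\<lambda>x. u * x)"
  using filt_mult[of u 1] by (simp add: filt_raising_def scale_mult_right distrib_left)

lemma filt_raising_ad: "u \<in> F 1 \<Longrightarrow> filt_raising scale F (ad u)"
  using filt_mult[of u 1] filt_mult[of _ _ u 1]
  by (auto simp: filt_raising_def ad_def scale_mult_right scale_mult_left scale_right_diff_distrib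
      algebra_simps intro!: filt_diff)

context
  fixes T assumes T: "filt_raising scale F T"
begin

lemma funpow_filt: "x \<in> F m \<Longrightarrow> (T ^^ n) x \<in> F (n + m)"
  by (induction n) (use T in \<open>auto simp: filt_raising_def\<close>)

lemma funpow_linear:
  "(T ^^ n) (x + y) = (T ^^ n) x + (T ^^ n) y" "(T ^^ n) (scale c x) = scale c ((T ^^ n) x)"
  using T by (induction n) (auto simp: filt_raising_def)

lemma funpow_zero: "(T ^^ n) 0 = 0"
  using funpow_linear(2)[of n 0 0] by simp

lemma funpow_diff: "(T ^^ n) (x - y) = (T ^^ n) x - (T ^^ n) y"
  using funpow_linear(1)[of n "x - y" y] by (simp add: algebra_simps)

lemma funpow_sum: "(T ^^ n) (sum f I) = (\<Sum>i\<in>I. (T ^^ n) (f i))"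
  by (induction I rule: infinite_finite_induct) (auto simp: funpow_zero funpow_linear)

lemma fps_operator_term_filt: "scale (fps_nth f n) ((T ^^ n) x) \<in> F n"
  using funpow_filt[of x 0 n] by (intro filt_scale) simp

lemma fps_operator_sums:
  "filt_sums F (\<lambda>n. scale (fps_nth f n) ((T ^^ n) x)) (fps_operator scale F f T x)"
  unfolding fps_operator_def by (intro filt_sums_suminf fps_operator_term_filt)

lemma fps_operator_one: "fps_operator scale F 1 T x = x"
proof -
  have "filt_sums F (\<lambda>n. scale (fps_nth 1 n) ((T ^^ n) x)) x"
    unfolding filt_sums_iff[OF fps_operator_term_filt]
  proof
    fix n
    show "x - (\<Sum>i<n. scale (fps_nth 1 i) ((T ^^ i) x)) \<in> F n"
      by (cases n) (simp_all add: sum.lessThan_Suc_shift del: sum.lessThan_Suc)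
  qed
  then show ?thesis unfolding fps_operator_def by (rule filt_suminf_eqI)
qed

text \<open>Evaluation of power series at \<open>T\<close> is multiplicative, so identities between power series
  carry over to operators.\<close>

lemma fps_operator_mult:
  "fps_operator scale F f T (fps_operator scale F g T x) = fps_operator scale F (f * g) T x"
proof -
  define y where "y = fps_operator scale F g T x"
  define z where "z = fps_operator scale F f T y"
  let ?h = "\<lambda>i j. scale (fps_nth f i * fps_nth g j) ((T ^^ (i + j)) x)"
  have "z - (\<Sum>n<N. scale (fps_nth (f * g) n) ((T ^^ n) x)) \<in> F N" for N
  proof -
    let ?y = "\<Sum>j<N. scale (fps_nth g j) ((T ^^ j) x)"
    have "z - (\<Sum>i<N. scale (fps_nth f i) ((T ^^ i) y)) \<in> F N"
      unfolding z_def by (rule filt_sums_remainder[OF fps_operator_sums fps_operator_term_filt])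
    \<comment> \<open>The powers of \<open>T\<close> map the remainder \<open>y - ?y\<close>, an element of \<open>F N\<close>, into \<open>F N\<close>.\<close>
    moreover have "(\<Sum>i<N. scale (fps_nth f i) ((T ^^ i) y))
        - (\<Sum>i<N. scale (fps_nth f i) ((T ^^ i) ?y)) \<in> F N"
    proof -
      have "y - ?y \<in> F N"
        unfolding y_def by (rule filt_sums_remainder[OF fps_operator_sums fps_operator_term_filt])
      then have "(T ^^ i) y - (T ^^ i) ?y \<in> F N" for i
        using filt_le[OF le_add2 funpow_filt] by (metis funpow_diff)
      then show ?thesis
        unfolding sum_subtractf[symmetric] scale_right_diff_distrib[symmetric]
        by (intro filt_sum filt_scale)
    qed
    ultimately have "z - (\<Sum>i<N. scale (fps_nth f i) ((T ^^ i) ?y)) \<in> F N"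
      by (rule filt_trans)
    moreover have "(\<Sum>i<N. scale (fps_nth f i) ((T ^^ i) ?y)) = (\<Sum>i<N. \<Sum>j<N. ?h i j)"
      by (simp add: funpow_sum funpow_linear funpow_add scale_sum_right)
    moreover have "(\<Sum>n<N. \<Sum>i\<le>n. ?h i (n - i)) = (\<Sum>n<N. scale (fps_nth (f * g) n) ((T ^^ n) x))"
      by (simp add: fps_mult_nth scale_sum_left atLeast0AtMost)
    moreover have "?h i j \<in> F (i + j)" for i j
      using funpow_filt[of x 0 "i + j"] by (intro filt_scale) simp
    ultimately show ?thesis
      using filt_trans square_sum_minus_triangle_sum[of ?h N] by presburger
  qed
  then have "filt_sums F (\<lambda>n. scale (fps_nth (f * g) n) ((T ^^ n) x)) z"
    by (subst filt_sums_iff[OF fps_operator_term_filt]) blast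
  then show ?thesis
    unfolding fps_operator_def[of scale F "f * g"] z_def[symmetric] y_def[symmetric]
    by (rule filt_suminf_eqI[symmetric])
qed

end

section \<open>The exponential\<close>

lemma left_mult_funpow: "((\<lambda>x. u * x) ^^ n) y = u ^ n * y"
  for u y :: 'a
  by (induction n) (simp_all add: mult.assoc)

lemma filt_exp_eq_fps_operator:
  "filt_exp scale F (scale t u) = fps_operator scale F (fps_exp t) (\<lambda>x. u * x) 1"
proof -
  have "scale t u ^ n = scale (t ^ n) (u ^ n)" for n
    by (induction n) (simp_all add: scale_mult_left scale_mult_right)
  then show ?thesis
    by (simp add: filt_exp_def fps_operator_def left_mult_funpow)
qed

text \<open>With left multiplication by \<open>u\<close> as the operator, this is the identity
  $e^X e^{-X} = 1$ of power series.\<close>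

lemma filt_exp_minus_inverse:
  assumes u: "u \<in> F 1"
  shows "filt_exp scale F u * filt_exp scale F (- u) = 1"
proof -
  let ?L = "\<lambda>x. u * x" and ?v = "filt_exp scale F (- u)"
  have L: "filt_raising scale F ?L"
    by (rule filt_raising_left_mult[OF u])
  have v: "?v = fps_operator scale F (fps_exp (- 1)) ?L 1"
    using filt_exp_eq_fps_operator[of "- 1" u] by simp
  have deg: "scale (1 / fact n) (u ^ n) \<in> F n" for n
    by (intro filt_scale filt_power u)
  \<comment> \<open>Multiplying the exponential series by \<open>?v\<close> termwise exhibits the product as the operator
    series $e^X$ at \<open>?L\<close>, applied to \<open>?v\<close>.\<close>
  have "filt_sums F (\<lambda>n. scale (1 / fact n) (u ^ n) * ?v) (filt_exp scale F u * ?v)"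
  proof (subst filt_sums_iff)
    show "scale (1 / fact n) (u ^ n) * ?v \<in> F n" for n
      using filt_mult[OF deg, of ?v 0] by simp
    have "(filt_exp scale F u - (\<Sum>i<n. scale (1 / fact i) (u ^ i))) * ?v \<in> F (n + 0)" for n
      by (rule filt_mult[OF filt_sums_remainder[OF filt_exp_sums[OF u] deg]]) simp
    then show "\<forall>n. filt_exp scale F u * ?v - (\<Sum>i<n. scale (1 / fact i) (u ^ i) * ?v) \<in> F n"
      by (simp add: left_diff_distrib sum_distrib_right)
  qed
  then have "filt_exp scale F u * ?v = fps_operator scale F (fps_exp 1) ?L ?v"
    by (simp add: fps_operator_def left_mult_funpow scale_mult_left filt_suminf_eqI)
  also have "\<dots> = fps_operator scale F (fps_exp 1 * fps_exp (- 1)) ?L 1"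
    unfolding v by (rule fps_operator_mult[OF L])
  also have "fps_exp 1 * fps_exp (- 1) = (1 :: 'k fps)"
    by (simp flip: fps_exp_add_mult)
  finally show ?thesis
    by (simp add: fps_operator_one[OF L])
qed

text \<open>Each $u^i c u^{n-i}$ is rewritten by $u v = \operatorname{ad} u\,(v) + v u$; since
  $\operatorname{ad} u$ commutes with right multiplication by $u$, this is the expansion of
  $((T + M)^{n+1} - M^{n+1})/T$ for commuting $T$ and $M$.\<close>

lemma sum_power_mult_power:
  "(\<Sum>i\<le>n. u ^ i * c * u ^ (n - i)) =
   (\<Sum>k\<le>n. scale (of_nat (Suc n choose Suc k)) ((ad u ^^ k) c * u ^ (n - k)))"
proof (induction n)
  case (Suc n)
  let ?t = "\<lambda>k m. (ad u ^^ k) c * u ^ m"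
  let ?b = "\<lambda>n k. of_nat (n choose k) :: 'k"
  have step: "u * ?t k m = ?t (Suc k) m + ?t k (Suc m)" for k m
    by (simp add: ad_def algebra_simps)
  have "(\<Sum>i\<le>Suc n. u ^ i * c * u ^ (Suc n - i))
      = c * u ^ Suc n + u * (\<Sum>i\<le>n. u ^ i * c * u ^ (n - i))"
    by (simp only: sum.atMost_Suc_shift sum_distrib_left) (simp add: mult.assoc)
  also have "u * (\<Sum>i\<le>n. u ^ i * c * u ^ (n - i))
      = (\<Sum>k\<le>n. scale (?b (Suc n) (Suc k)) (u * ?t k (n - k)))"
    by (simp only: Suc sum_distrib_left scale_mult_right)
  also have "\<dots> = (\<Sum>k\<le>n. scale (?b (Suc n) (Suc k)) (?t (Suc k) (n - k)))
      + (\<Sum>k\<le>n. scale (?b (Suc n) (Suc k)) (?t k (Suc n - k)))"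
    by (simp only: step scale_right_distrib sum.distrib) (simp add: Suc_diff_le)
  also have "(\<Sum>k\<le>n. scale (?b (Suc n) (Suc k)) (?t k (Suc n - k)))
      = (\<Sum>k\<le>Suc n. scale (?b (Suc n) (Suc k)) (?t k (Suc n - k)))"
    by (simp add: binomial_eq_0 del: binomial_Suc_Suc funpow.simps)
  also have "c * u ^ Suc n + ((\<Sum>k\<le>n. scale (?b (Suc n) (Suc k)) (?t (Suc k) (n - k))) + \<dots>)
      = (\<Sum>k\<le>Suc n. scale (?b (Suc n) k) (?t k (Suc n - k)))
        + (\<Sum>k\<le>Suc n. scale (?b (Suc n) (Suc k)) (?t k (Suc n - k)))"
    by (simp only: sum.atMost_Suc_shift[of "\<lambda>k. scale (?b (Suc n) k) (?t k (Suc n - k))"])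
      (simp add: add.assoc)
  also have "\<dots> = (\<Sum>k\<le>Suc n. scale (?b (Suc (Suc n)) (Suc k)) (?t k (Suc n - k)))"
    by (simp only: sum.distrib[symmetric] scale_left_distrib[symmetric])
      (simp only: binomial_Suc_Suc of_nat_add)
  finally show ?case .
qed simp

end

text \<open>The series $(e^X - 1)/X$.\<close>

definition exp_quotient_fps :: "'k::field_char_0 fps" where
  "exp_quotient_fps = Abs_fps (\<lambda>n. 1 / fact (Suc n))"

lemma exp_quotient_times_bernoulli: "exp_quotient_fps * bernoulli_fps = (1 :: 'k::field_char_0 fps)"
proof -
  have "fps_exp 1 - 1 = fps_X * (exp_quotient_fps :: 'k fps)"
  proof (rule fps_ext)
    show "fps_nth (fps_exp 1 - 1) n = fps_nth (fps_X * (exp_quotient_fps :: 'k fps)) n" for n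
      by (cases n) (simp_all add: exp_quotient_fps_def distrib_right)
  qed
  with bernoulli_fps_times[where 'k='k]
  have "fps_X * (exp_quotient_fps * bernoulli_fps) = fps_X * (1 :: 'k fps)"
    by (simp add: mult_ac)
  then show ?thesis by (simp del: mult_1_right)
qed

section \<open>The recursion and the two equations\<close>

context complete_filtered_rota_baxter_algebra
begin

lemma R_add: "R (x + y) = R x + R y"
  using R_linear by (simp add: Vector_Spaces.linear.axioms module_hom.add linear_iff_module_hom)

lemma R_scale: "R (scale c x) = scale c (R x)"
  using R_linear by (simp add: module_hom.scale linear_iff_module_hom)

lemma R_zero: "R 0 = 0"
  using R_scale[of 0 0] by simp

lemma R_minus: "R (- x) = - R x"
  using R_scale[of "- 1" x] by simp

lemma R_diff: "R (x - y) = R x - R y"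
  using R_add[of x "- y"] by (simp add: R_minus)

lemma R_sum: "R (sum f I) = (\<Sum>i\<in>I. R (f i))"
  by (induction I rule: infinite_finite_induct) (auto simp: R_zero R_add)

lemma R_in: "x \<in> F n \<Longrightarrow> R x \<in> F n"
  using R_filt by blast

lemma R_sums:
  assumes "filt_sums F f s"
  shows "filt_sums F (\<lambda>n. R (f n)) (R s)"
  unfolding filt_sums_def filt_tendsto_def
proof
  fix n
  have "\<forall>\<^sub>F m in sequentially. (\<Sum>i<m. f i) - s \<in> F n"
    using assms by (simp add: filt_sums_def filt_tendsto_def)
  then show "\<forall>\<^sub>F m in sequentially. (\<Sum>i<m. R (f i)) - R s \<in> F n"
    by eventually_elim (use R_in in \<open>fastforce simp: R_diff R_sum\<close>)
qed

lemma cbhd_step_eq_fps_operator: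
  assumes "c \<in> F 1"
  shows "cbhd_step scale F R a c = fps_operator scale F bernoulli_fps (ad (R c)) a"
proof -
  have "fps_nth bernoulli_fps 0 = (1 :: 'k)"
    using bernoulli_0_1(1)[where 'k='k] by (simp add: bernoulli_def)
  with filt_sums_split_head[OF fps_operator_sums[OF filt_raising_ad[OF R_in[OF assms]],
      where f = bernoulli_fps and x = a]]
  have "filt_sums F (\<lambda>n. scale (bernoulli (Suc n) / fact (Suc n)) ((ad (R c) ^^ Suc n) a))
      (fps_operator scale F bernoulli_fps (ad (R c)) a - a)"
    by (simp add: bernoulli_def del: fact_Suc funpow.simps)
  from filt_suminf_eqI[OF this] show ?thesis
    by (simp add: cbhd_step_def)
qed

lemma cbhd_step_in:
  assumes "a \<in> F 1" "c \<in> F 1"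
  shows "cbhd_step scale F R a c \<in> F 1"
proof -
  have "fps_operator scale F bernoulli_fps (ad (R c)) a
      - (\<Sum>i<1. scale (fps_nth bernoulli_fps i) ((ad (R c) ^^ i) a)) \<in> F 1"
    by (rule filt_sums_remainder)
      (intro fps_operator_sums fps_operator_term_filt filt_raising_ad R_in assms)+
  then have "cbhd_step scale F R a c - scale (fps_nth bernoulli_fps 0) a \<in> F 1"
    by (simp add: cbhd_step_eq_fps_operator[OF assms(2)])
  from filt_add[OF this filt_scale[OF assms(1), of "fps_nth bernoulli_fps 0"]] show ?thesis
    by simp
qed

lemma ad_filt: "x \<in> F m \<Longrightarrow> y \<in> F n \<Longrightarrow> ad x y \<in> F (m + n)"
  using filt_mult[of x m y n] filt_mult[of y n x m] by (auto simp: ad_def add.commute intro: filt_diff)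

text \<open>The difference telescopes into terms with one factor \<open>ad (u - v)\<close>, which acts on
  an element of \<open>F 1\<close> because \<open>a\<close> lies there; this is where the contraction gains a degree.\<close>

lemma ad_funpow_diff_filt:
  assumes a: "a \<in> F 1" and u: "u \<in> F 1" and v: "v \<in> F 1" and uv: "u - v \<in> F n"
  shows "(ad u ^^ k) a - (ad v ^^ k) a \<in> F (Suc n)"
proof (induction k)
  case (Suc k)
  let ?x = "(ad u ^^ k) a" and ?y = "(ad v ^^ k) a"
  have "ad u (?x - ?y) \<in> F (Suc n)"
    using ad_filt[OF u Suc] by (rule filt_le[rotated]) simp
  moreover have "?y \<in> F 1"
    using funpow_filt[OF filt_raising_ad[OF v] a, of k] by (rule filt_le[rotated]) simp
  then have "ad (u - v) ?y \<in> F (Suc n)"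
    using ad_filt[OF uv] by fastforce
  ultimately have "ad u (?x - ?y) + ad (u - v) ?y \<in> F (Suc n)"
    by (rule filt_add)
  moreover have "ad u (x - y) + ad (u - v) y = ad u x - ad v y" for x y
    by (simp add: ad_def algebra_simps)
  ultimately show ?case
    by simp
qed simp

lemma cbhd_step_contraction:
  assumes "a \<in> F 1" "c \<in> F 1" "d \<in> F 1" "c - d \<in> F n"
  shows "cbhd_step scale F R a c - cbhd_step scale F R a d \<in> F (Suc n)"
proof -
  let ?S = "\<lambda>c. \<Sum>i<Suc n. scale (fps_nth bernoulli_fps i) ((ad (R c) ^^ i) a)"
  have trunc: "cbhd_step scale F R a c - ?S c \<in> F (Suc n)" if "c \<in> F 1" for c
    unfolding cbhd_step_eq_fps_operator[OF that]
    by (rule filt_sums_remainder)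
      (intro fps_operator_sums fps_operator_term_filt filt_raising_ad R_in that)+
  have "R c - R d \<in> F n"
    using R_in[OF assms(4)] by (simp add: R_diff)
  then have "?S c - ?S d \<in> F (Suc n)"
    unfolding sum_subtractf[symmetric] scale_right_diff_distrib[symmetric]
    by (intro filt_sum filt_scale ad_funpow_diff_filt R_in assms)
  with trunc[OF assms(2)] filt_commute[OF trunc[OF assms(3)]] show ?thesis
    by (meson filt_trans)
qed

lemma cbhd_recursion_fixed_point:
  assumes "a \<in> F 1"
  shows "cbhd_recursion scale F R a \<in> F 1"
    and "cbhd_step scale F R a (cbhd_recursion scale F R a) = cbhd_recursion scale F R a"
proof -
  obtain x where "filt_tendsto F (\<lambda>k. (cbhd_step scale F R a ^^ k) a) x" "x \<in> F 1"
    "cbhd_step scale F R a x = x"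
    using contraction_iterates_tendsto[of 1 "cbhd_step scale F R a" a]
      cbhd_step_contraction cbhd_step_in assms by blast
  then show "cbhd_recursion scale F R a \<in> F 1"
    "cbhd_step scale F R a (cbhd_recursion scale F R a) = cbhd_recursion scale F R a"
    unfolding cbhd_recursion_def by (simp_all add: filt_lim_eqI)
qed

text \<open>The Rota--Baxter relation is integration by parts, with \<open>R\<close> as the integral: \<open>c\<close> is the
  derivative of \<open>R c\<close>, and the sum is the Leibniz expansion of the derivative of the power.\<close>

lemma R_geometric_sum: "R (\<Sum>i\<le>n. R c ^ i * c * R c ^ (n - i)) = R c ^ Suc n"
proof (induction n)
  case (Suc n)
  let ?S = "\<lambda>n. \<Sum>i\<le>n. R c ^ i * c * R c ^ (n - i)"
  have "?S (Suc n) = R c ^ Suc n * c + ?S n * R c"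
    by (simp add: sum_distrib_right Suc_diff_le mult.assoc power_Suc2 del: power_Suc)
  also have "R \<dots> = R (R (?S n) * c) + R (?S n * R c)"
    by (simp only: R_add Suc)
  also have "\<dots> = R (?S n) * R c"
    by (simp only: rota_baxter)
  finally show ?case
    by (simp only: Suc power_Suc2)
qed simp

text \<open>Termwise, $R(c)^{n+1}/(n+1)!$ is the image under \<open>R\<close> of the Cauchy product of
  $\psi(\operatorname{ad} R(c))(c)$ and $\exp(R(c))$, where $\psi(z) = (e^z-1)/z$. This holds for
  every \<open>c\<close> in \<open>F 1\<close>; the recursion picks the \<open>c\<close> for which the first factor is \<open>a\<close>.\<close>

lemma filt_exp_R:
  assumes c: "c \<in> F 1"
  shows "filt_exp scale F (R c)
    = 1 + R (fps_operator scale F exp_quotient_fps (ad (R c)) c * filt_exp scale F (R c))"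
proof -
  let ?u = "R c" and ?e = "filt_exp scale F (R c)"
  let ?S = "\<lambda>n. \<Sum>i\<le>n. ?u ^ i * c * ?u ^ (n - i)"
  let ?q = "\<lambda>n. scale (fps_nth exp_quotient_fps n) ((ad ?u ^^ n) c)"
  let ?p = "\<lambda>n. scale (1 / fact n) (?u ^ n)"
  have u: "?u \<in> F 1"
    by (rule R_in[OF c])
  have "?q k * ?p (n - k)
      = scale (1 / fact (Suc n)) (scale (of_nat (Suc n choose Suc k)) ((ad ?u ^^ k) c * ?u ^ (n - k)))"
    if "k \<le> n" for k n
    using binomial_fact[of "Suc k" "Suc n", where 'a='k] that
    by (simp add: exp_quotient_fps_def scale_mult_left scale_mult_right del: fact_Suc binomial_Suc_Suc)
  then have cauchy: "(\<Sum>k\<le>n. ?q k * ?p (n - k)) = scale (1 / fact (Suc n)) (?S n)" for n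
    by (simp add: sum_power_mult_power scale_sum_right del: fact_Suc binomial_Suc_Suc)
  have "filt_sums F (\<lambda>n. \<Sum>k\<le>n. ?q k * ?p (n - k))
      (fps_operator scale F exp_quotient_fps (ad ?u) c * ?e)"
    by (intro filt_sums_Cauchy_product fps_operator_term_filt fps_operator_sums filt_raising_ad
        filt_exp_sums filt_scale filt_power u)
  from R_sums[OF this]
  have "filt_sums F (\<lambda>n. ?p (Suc n)) (R (fps_operator scale F exp_quotient_fps (ad ?u) c * ?e))"
    by (simp only: cauchy R_scale R_geometric_sum)
  moreover have "filt_sums F (\<lambda>n. ?p (Suc n)) (?e - 1)"
    using filt_sums_split_head[OF filt_exp_sums[OF u]] by simp
  ultimately show ?thesis
    using filt_sums_unique by (metis add_diff_cancel_left' diff_add_cancel)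
qed

lemma filt_exp_R_cbhd_recursion:
  assumes a: "a \<in> F 1"
  defines "c \<equiv> cbhd_recursion scale F R a"
  shows "filt_exp scale F (R c) = 1 + R (a * filt_exp scale F (R c))"
proof -
  have c: "c \<in> F 1"
    unfolding c_def by (rule cbhd_recursion_fixed_point[OF a])
  have ad: "filt_raising scale F (ad (R c))"
    by (rule filt_raising_ad[OF R_in[OF c]])
  have "fps_operator scale F bernoulli_fps (ad (R c)) a = c"
    using cbhd_recursion_fixed_point(2)[OF a] cbhd_step_eq_fps_operator[OF c]
    by (simp add: c_def)
  then have "fps_operator scale F exp_quotient_fps (ad (R c)) c
      = fps_operator scale F (exp_quotient_fps * bernoulli_fps) (ad (R c)) a"
    using fps_operator_mult[OF ad] by metis
  also have "\<dots> = a"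
    by (simp add: exp_quotient_times_bernoulli fps_operator_one[OF ad])
  finally show ?thesis
    using filt_exp_R[OF c] by simp
qed

text \<open>With $X = R(ax)$ and $Y = -R(ya)$ the Rota--Baxter relation reads
  $YX = -R((1-y)ax) - R(ya(x-1)) = -X - Y$, that is, $(1+Y)(1+X) = 1$.\<close>

lemma rota_baxter_solutions_inverse:
  assumes x: "x = 1 + R (a * x)" and y: "y = 1 - R (y * a)"
  shows "y * x = 1"
proof -
  have "R (y * a) * R (a * x) = R (R (y * a) * (a * x)) + R (y * a * R (a * x))"
    by (rule rota_baxter)
  also have "R (y * a) = 1 - y"
    using y by (metis add_diff_cancel_left' diff_add_cancel)
  also have "R (a * x) = x - 1"
    using x by (metis add_diff_cancel_left')
  also have "R ((1 - y) * (a * x)) + R (y * a * (x - 1)) = R (a * x) - R (y * a)"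
    by (simp add: R_add[symmetric] R_diff[symmetric] algebra_simps)
  also have "\<dots> = (x - 1) - (1 - y)"
    using x y by (metis add_diff_cancel_left' diff_add_cancel)
  finally show ?thesis
    by (simp add: algebra_simps)
qed

lemma right_equation_contraction:
  assumes "a \<in> F 1" "y - z \<in> F n"
  shows "(1 - R (y * a)) - (1 - R (z * a)) \<in> F (Suc n)"
proof -
  have "R ((z - y) * a) \<in> F (Suc n)"
    using filt_mult[OF filt_commute[OF assms(2)] assms(1)] by (intro R_in) simp
  then show ?thesis
    by (simp add: R_diff left_diff_distrib)
qed

lemma left_equation_contraction:
  assumes "a \<in> F 1" "x - z \<in> F n"
  shows "(1 + R (a * x)) - (1 + R (a * z)) \<in> F (Suc n)"
proof -
  have "R (a * (x - z)) \<in> F (Suc n)"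
    using filt_mult[OF assms(1,2)] by (intro R_in) simp
  then show ?thesis
    by (simp add: R_diff right_diff_distrib)
qed

lemma left_equation_unique:
  assumes "a \<in> F 1" "x = 1 + R (a * x)" "z = 1 + R (a * z)"
  shows "x = z"
  by (rule contraction_fixed_point_unique[where S = UNIV and f = "\<lambda>x. 1 + R (a * x)"])
    (use assms left_equation_contraction in auto)

lemma right_equation_ex1:
  assumes "a \<in> F 1"
  shows "\<exists>!y. y = 1 - R (y * a)"
proof (rule ex_ex1I)
  show "\<exists>y. y = 1 - R (y * a)"
    using contraction_iterates_tendsto[of 0 "\<lambda>y. 1 - R (y * a)" 0]
      right_equation_contraction[OF assms] by (metis filt_UNIV)
next
  show "y = z" if "y = 1 - R (y * a)" "z = 1 - R (z * a)" for y z
    by (rule contraction_fixed_point_unique[where S = UNIV and f = "\<lambda>y. 1 - R (y * a)"])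
      (use that right_equation_contraction[OF assms] in auto)
qed

text \<open>The solution \<open>y\<close> of the equation is a left inverse of the exponential of \<open>R c\<close>, and the
  exponential of \<open>- R c\<close> is a right inverse, so the two agree.\<close>

lemma filt_exp_minus_R_cbhd_recursion:
  assumes a: "a \<in> F 1"
  defines "c \<equiv> cbhd_recursion scale F R a"
  shows "filt_exp scale F (- R c) = 1 - R (filt_exp scale F (- R c) * a)"
proof -
  obtain y where y: "y = 1 - R (y * a)"
    using right_equation_ex1[OF a] by blast
  let ?x = "filt_exp scale F (R c)" and ?x' = "filt_exp scale F (- R c)"
  have "R c \<in> F 1"
    unfolding c_def by (intro R_in cbhd_recursion_fixed_point(1) a)
  then have "?x * ?x' = 1"
    by (rule filt_exp_minus_inverse)
  moreover have "y * ?x = 1"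
    using rota_baxter_solutions_inverse[OF _ y] filt_exp_R_cbhd_recursion[OF a]
    unfolding c_def by blast
  ultimately have "y = ?x'"
    by (metis mult.assoc mult_1_left mult_1_right)
  with y show ?thesis
    by simp
qed

end

theorem corollary9p1:
  fixes scale :: "'k::field_char_0 \<Rightarrow> 'a::{ring,monoid_mult} \<Rightarrow> 'a"
    and F :: "nat \<Rightarrow> 'a set"
    and R \<chi> :: "'a \<Rightarrow> 'a"
  assumes "complete_filtered_rota_baxter_algebra scale F R"
    and "\<chi> = cbhd_recursion scale F R"
  shows "\<forall>a \<in> F 1.
      (\<chi> a \<in> F 1 \<and>
       \<chi> a = fps_operator scale F (fps_X / (fps_exp 1 - 1)) (ad (R (\<chi> a))) a \<and>
       \<chi> a = a + filt_suminf F
         (\<lambda>n. scale (bernoulli (Suc n) / fact (Suc n)) ((ad (R (\<chi> a)) ^^ Suc n) a)) \<and>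
       (\<forall>c \<in> F 1. c = a + filt_suminf F
         (\<lambda>n. scale (bernoulli (Suc n) / fact (Suc n)) ((ad (R c) ^^ Suc n) a)) \<longrightarrow> c = \<chi> a)) \<and>
      ((\<exists>!x. x = 1 + R (a * x)) \<and>
       filt_exp scale F (R (\<chi> a)) = 1 + R (a * filt_exp scale F (R (\<chi> a)))) \<and>
      ((\<exists>!y. y = 1 - R (y * a)) \<and>
       filt_exp scale F (R (- \<chi> a)) = 1 - R (filt_exp scale F (R (- \<chi> a)) * a) \<and>
       filt_exp scale F (R (- \<chi> a)) = filt_exp scale F (- R (\<chi> a)))"
proof -
  interpret complete_filtered_rota_baxter_algebra scale F R
    by fact
  have step: "a + filt_suminf F (\<lambda>n. scale (bernoulli (Suc n) / fact (Suc n)) ((ad (R c) ^^ Suc n) a))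
      = cbhd_step scale F R a c" for a c
    by (simp only: cbhd_step_def)
  have unique: "c = \<chi> a" if "a \<in> F 1" "c \<in> F 1" "c = cbhd_step scale F R a c" for a c
    by (rule contraction_fixed_point_unique[where S = "F 1" and f = "cbhd_step scale F R a"])
      (use that cbhd_step_contraction[OF that(1)] cbhd_recursion_fixed_point[OF that(1)] assms(2)
       in auto)
  have ex1: "\<exists>!x. x = 1 + R (a * x)" if "a \<in> F 1" for a
    using filt_exp_R_cbhd_recursion[OF that] left_equation_unique[OF that] by blast
  show ?thesis
    unfolding step bernoulli_fps_def[symmetric] R_minus
  proof (intro ballI conjI impI)
    fix a assume a: "a \<in> F 1"
    note fixed = cbhd_recursion_fixed_point[OF a, folded assms(2)]
    show "\<chi> a \<in> F 1" "\<chi> a = cbhd_step scale F R a (\<chi> a)"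
      using fixed by simp_all
    then show "\<chi> a = fps_operator scale F bernoulli_fps (ad (R (\<chi> a))) a"
      using cbhd_step_eq_fps_operator by metis
    show "c = \<chi> a" if "c \<in> F 1" "c = cbhd_step scale F R a c" for c
      by (rule unique[OF a that])
    show "\<exists>!x. x = 1 + R (a * x)"
      by (rule ex1[OF a])
    show "filt_exp scale F (R (\<chi> a)) = 1 + R (a * filt_exp scale F (R (\<chi> a)))"
      unfolding assms(2) by (rule filt_exp_R_cbhd_recursion[OF a])
    show "\<exists>!y. y = 1 - R (y * a)"
      by (rule right_equation_ex1[OF a])
    show "filt_exp scale F (- R (\<chi> a)) = 1 - R (filt_exp scale F (- R (\<chi> a)) * a)"
      unfolding assms(2) by (rule filt_exp_minus_R_cbhd_recursion[OF a])
  qed (rule refl)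
qed

end
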